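(* Let $m,n\ge 2$ be integers and let $p_1,\dots,p_m>0$ with $\sum_{i=1}^m p_i=1$ be the symbol probabilities of a Bernoulli source. (a) There exists a constant $c>0$ (depending only on $n$ and $p_1,\dots,p_m$) such that for every integer $L\ge\log_n m$ there is a decipherable word-based code from the source alphabet $\{a_1,\dots,a_m\}$ to the output alphabet $\{b_1,\dots,b_n\}$ with $|\phi(A_j)|=L$ for all $j$, whose redundancy $R$ and average delay $\bar N$ satisfy $R\le c\,\bar N^{-1}$. (b) If $p_1=\dots=p_m=1/m$, then there exists a constant $c>0$ (depending only on $n$ and $m$) such that for infinitely many positive integers $L$ there is a decipherable word-based code with $|\phi(A_j)|=L$ for all $j$ and $R\le c\,\bar N^{-2}$.
   Context: A Bernoulli source produces independent symbols from the input alphabet $\{a_1,\dots,a_m\}$ with probabilities $p_1,\dots,p_m$; its entropy is $H=-\sum_{i=1}^m p_i\log_2 p_i$. A message is an infinite sequence of input symbols. For a word $A=a_{i_1}\cdots a_{i_k}$, $|A|=k$ is its length and $p(A)=p_{i_1}\cdots p_{i_k}$. A word-based code consists of a finite set of distinct nonempty words $A_1,A_2,\dots$ over the input alphabet such that every message can be uniquely represented as an infinite concatenation of words $A_j$ (in particular, the set is prefix-free and every message begins with one of its words), together with a map $\phi$ assigning to each $A_j$ a word $\phi(A_j)$ over the output alphabet $\{b_1,\dots,b_n\}$. The code is decipherable if $\phi(A_{i_1})\cdots\phi(A_{i_s})=\phi(A_{j_1})\cdots\phi(A_{j_t})$ always implies $s=t$ and $i_k=j_k$ for $k=1,\dots,s$.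 Average delay: $\bar N=\sum_j p(A_j)|A_j|$. Redundancy: $R=\bar N^{-1}\sum_j p(A_j)|\phi(A_j)|-H/\log_2 n$. *)

theory Defs
  imports Complex_Main "HOL-Library.Stream"
begin

text \<open>
  Words are lists and messages are streams. The words of a code are nonempty, so
  \<^const>\<open>flat\<close> is the infinite concatenation on streams of code words.
  The values of \<open>\<phi>\<close> outside the word set \<open>W\<close> are irrelevant in all definitions below.
\<close>

definition word_based_code :: "'a set \<Rightarrow> 'b set \<Rightarrow> 'a list set \<Rightarrow> ('a list \<Rightarrow> 'b list) \<Rightarrow> bool" where
  "word_based_code A B W \<phi> \<longleftrightarrow>
     finite W \<and> W \<subseteq> lists A \<and> [] \<notin> W \<and>
     (\<forall>x\<in>streams A. \<exists>!ws. ws \<in> streams W \<and> flat ws = x) \<and>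
     \<phi> ` W \<subseteq> lists B"

definition decipherable :: "'a list set \<Rightarrow> ('a list \<Rightarrow> 'b list) \<Rightarrow> bool" where
  "decipherable W \<phi> \<longleftrightarrow>
     (\<forall>us\<in>lists W. \<forall>vs\<in>lists W. concat (map \<phi> us) = concat (map \<phi> vs) \<longrightarrow> us = vs)"

definition word_prob :: "('a \<Rightarrow> real) \<Rightarrow> 'a list \<Rightarrow> real" where
  "word_prob p w = prod_list (map p w)"

definition source_entropy :: "'a set \<Rightarrow> ('a \<Rightarrow> real) \<Rightarrow> real" where
  "source_entropy A p = - (\<Sum>a\<in>A. p a * log 2 (p a))"

definition avg_delay :: "('a \<Rightarrow> real) \<Rightarrow> 'a list set \<Rightarrow> real" where
  "avg_delay p W = (\<Sum>w\<in>W. word_prob p w * real (length w))"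

definition redundancy ::
  "'a set \<Rightarrow> 'b set \<Rightarrow> ('a \<Rightarrow> real) \<Rightarrow> 'a list set \<Rightarrow> ('a list \<Rightarrow> 'b list) \<Rightarrow> real" where
  "redundancy A B p W \<phi> =
     (\<Sum>w\<in>W. word_prob p w * real (length (\<phi> w))) / avg_delay p W
     - source_entropy A p / log 2 (real (card B))"

end

theory Submission
  imports Defs "HOL-Analysis.Kronecker_Approximation_Theorem"
begin

text \<open>
  Stop parsing as soon as the probability of the word read so far drops to a threshold
  \<open>t < 1\<close>. The words obtained are the leaves of a complete tree, and by the chain rule their
  entropy is \<open>N H\<close>, where \<open>N\<close> is the average delay and \<open>H\<close> the entropy of the source. As each of
  them has probability at most \<open>t\<close>, this entropy is at least \<open>log (1/t)\<close>, so an injective coding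
  into words of length \<open>L\<close> has redundancy at most \<open>(L - log\<^sub>n (1/t)) / N\<close>. All leaves have
  probability above \<open>t r\<close>, where \<open>r\<close> is the smallest symbol probability, so there are at most
  \<open>1 / (t r)\<close> of them; hence \<open>t = 1 / (r n^L)\<close> gives part (a). If this \<open>t\<close> is not below \<open>1\<close>, then
  \<open>L\<close> is bounded and parsing letter by letter suffices.

  For a uniform source and \<open>t = m^(-k)\<close> the leaves are all words of length \<open>k\<close>. There are at most
  \<open>n^L\<close> of them iff \<open>k \<le> L \<alpha>\<close> with \<open>\<alpha> = log\<^sub>m n\<close>, and the redundancy is \<open>(L \<alpha> - k) / (k \<alpha>)\<close>.
  For part (b) one therefore needs approximations \<open>0 \<le> L \<alpha> - k \<le> 1/L\<close> from below. If Dirichlet's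
  theorem yields \<open>q \<alpha> < p\<close> instead, take \<open>0 < u \<le> q\<close> and \<open>h\<close> with \<open>u p - h q = 1\<close>: then
  \<open>u \<alpha> - h\<close> lies between \<open>0\<close> and \<open>1/q\<close>.
\<close>

section \<open>Diophantine approximation from below\<close>

lemma coprime_inverse_upto:
  fixes p q :: int
  assumes "coprime p q" "q > 0"
  obtains u h where "0 < u" "u \<le> q" "u * p - h * q = 1"
proof -
  obtain a b where ab: "a * p + b * q = 1"
    using bezout_int[of p q] assms(1) by (auto simp: coprime_iff_gcd_eq_1)
  \<comment> \<open>Shifting \<open>a\<close> by a multiple of \<open>q\<close> keeps the Bezout
    identity solvable. The representative is taken in 1..q instead of 0..q-1, so that it is positive
    also for \<open>q = 1\<close>.\<close>
  define u where "u = (a - 1) mod q + 1"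
  have "a - 1 = q * ((a - 1) div q) + (a - 1) mod q"
    by simp
  then have u: "u = a - q * ((a - 1) div q)"
    unfolding u_def by linarith
  show thesis
  proof
    show "0 < u" "u \<le> q"
      using assms(2) pos_mod_bound[of q "a - 1"] pos_mod_sign[of q "a - 1"] unfolding u_def by linarith+
    show "u * p - (- b - ((a - 1) div q) * p) * q = 1"
      using ab by (simp add: u algebra_simps)
  qed
qed

lemma Dirichlet_approx_below:
  fixes \<alpha> :: real
  assumes "coprime p q" "q > 0" and close: "\<bar>real_of_int q * \<alpha> - real_of_int p\<bar> < 1 / real_of_int q"
  obtains L :: nat and k :: int
  where "L > 0" "int L \<le> q" "0 \<le> real L * \<alpha> - k" "real L * \<alpha> - k \<le> 1 / real_of_int q"
proof (cases "real_of_int q * \<alpha> \<ge> real_of_int p")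
  case True
  then show thesis
    using that[of "nat q" p] assms by auto
next
  case False
  obtain u h where u: "0 < u" "u \<le> q" and uh: "u * p - h * q = 1"
    using coprime_inverse_upto assms(1,2) by blast
  \<comment> \<open>With \<open>e\<close> the amount by which \<open>q * \<alpha>\<close> falls
    short of \<open>p\<close>, one gets \<open>u * \<alpha> - h = (u * p - h * q - u * e) / q = (1 -
    u * e) / q\<close>, and \<open>u \<le> q\<close> bounds \<open>u * e\<close> by
    \<open>q * e < 1\<close>.\<close>
  define e where "e = p - q * \<alpha>"
  have e: "0 < e" "q * e < 1"
    using False close assms(2) by (auto simp: e_def field_simps)
  have "real_of_int u * e \<le> real_of_int q * e"
    using u e by (intro mult_right_mono) auto
  then have ue: "u * e \<le> 1" "u * e \<ge> 0"
    using e u by (linarith, simp)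
  have "real_of_int u * p - h * q = 1"
    using uh by (metis of_int_1 of_int_diff of_int_mult)
  then have "(real_of_int u * \<alpha> - h) * q = 1 - u * e"
    by (simp add: e_def algebra_simps)
  then have eq: "real_of_int u * \<alpha> - h = (1 - u * e) / q"
    using assms(2) by (simp add: field_simps)
  show thesis
    by (rule that[of "nat u" h]) (use u ue assms(2) eq in \<open>auto simp: divide_right_mono\<close>)
qed

text \<open>For rational \<open>\<alpha>\<close> the multiples of a denominator give error 0. For
  irrational \<open>\<alpha>\<close> every error is positive, so finitely many \<open>L\<close>
  would leave a positive least error, which an approximation with large denominator
  undercuts.\<close>

lemma infinite_Dirichlet_approx_below:
  fixes \<alpha> :: real
  shows "infinite {L::nat. L > 0 \<and> (\<exists>k::int. 0 \<le> real L * \<alpha> - k \<and> real L * \<alpha> - k \<le> 1 / real L)}"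
    (is "infinite ?S")
proof (cases "\<alpha> \<in> \<rat>")
  case True
  then obtain a b where b: "b > 0" "\<alpha> = of_int a / of_int b"
    by (meson Rats_cases')
  have "(\<lambda>i. Suc i * nat b) ` UNIV \<subseteq> ?S"
  proof clarify
    fix i
    have "real (Suc i * nat b) * \<alpha> - of_int (int (Suc i) * a) = 0"
      using b by (simp add: field_simps)
    then show "Suc i * nat b > 0 \<and> (\<exists>k::int. 0 \<le> real (Suc i * nat b) * \<alpha> - k \<and>
        real (Suc i * nat b) * \<alpha> - k \<le> 1 / real (Suc i * nat b))"
      using b(1)
      by (intro conjI exI[of _ "int (Suc i) * a"]) (auto simp del: of_nat_Suc of_int_mult)
  qed
  moreover have "inj (\<lambda>i. Suc i * nat b)"
    using b by (auto intro: injI)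
  ultimately show ?thesis
    by (meson finite_subset range_inj_infinite)
next
  case False
  show ?thesis
  proof
    assume fin: "finite ?S"
    \<comment> \<open>The extra element 1 keeps the minimum meaningful if \<open>?S\<close> is
      empty.\<close>
    define \<mu> where "\<mu> = Min (insert 1 ((\<lambda>L. frac (real L * \<alpha>)) ` ?S))"
    have "frac (real L * \<alpha>) > 0" if "L > 0" for L :: nat
    proof -
      have "real L * \<alpha> \<notin> \<int>"
      proof
        assume "real L * \<alpha> \<in> \<int>"
        then have "real L * \<alpha> / real L \<in> \<rat>"
          using Ints_subset_Rats by (intro Rats_divide) auto
        then show False
          using False that by simp
      qed
      then show ?thesis
        by (simp add: frac_gt_0_iff)
    qed
    then have mu: "\<mu> > 0"
      unfolding \<mu>_def using fin by (subst Min_gr_iff) auto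
    obtain p q where pq: "(p, q) \<in> approx_set \<alpha>" "q > \<lceil>1 / \<mu>\<rceil>"
      using infinite_approx_set False rational_iff_finite_approx_set by blast
    have q: "q > 0" "coprime p q" "\<bar>\<alpha> - p / q\<bar> < 1 / (real_of_int q)\<^sup>2"
      using pq(1) by (auto simp: approx_set_def)
    have "q * \<bar>\<alpha> - p / q\<bar> = \<bar>q * \<alpha> - p\<bar>"
      using q(1) by (simp add: abs_if field_simps)
    moreover have "q * \<bar>\<alpha> - p / q\<bar> < 1 / q"
      using q(1) mult_strict_left_mono[OF q(3), of "real_of_int q"] by (simp add: power2_eq_square)
    ultimately have "\<bar>q * \<alpha> - p\<bar> < 1 / q"
      by simp
    then obtain L k where L: "L > 0" "int L \<le> q" "0 \<le> real L * \<alpha> - of_int k"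
        "real L * \<alpha> - k \<le> 1 / real_of_int q"
      using Dirichlet_approx_below q(1,2) by blast
    \<comment> \<open>As \<open>L \<le> q\<close>, the error bound \<open>1 / q\<close> puts
      \<open>L\<close> into \<open>?S\<close>; the sharper bound itself is kept for the
      contradiction with \<open>\<mu>\<close>.\<close>
    have "1 / real_of_int q \<le> 1 / real L"
      using L(1,2) by (intro divide_left_mono) auto
    with L have "L \<in> ?S"
      by force
    then have "\<mu> \<le> frac (real L * \<alpha>)"
      unfolding \<mu>_def using fin by (intro Min_le) auto
    also have "\<dots> \<le> real L * \<alpha> - k"
      using L(3) by (simp add: frac_def le_floor_iff)
    also have "\<dots> \<le> 1 / q"
      by (fact L)
    also have "\<dots> < \<mu>"
    proof -
      have "1 / \<mu> < q"
        using pq(2) by (simp add: ceiling_less_iff)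
      then show ?thesis
        using mu q(1) by (simp add: field_simps)
    qed
    finally show False
      by simp
  qed
qed

section \<open>Complete trees and unique parsing\<close>

text \<open>Sets of leaves of finite trees in which every inner node has one child for each letter of \<open>A\<close>.\<close>
inductive complete_leaves :: "'a set \<Rightarrow> 'a list set \<Rightarrow> bool" for A where
  root: "complete_leaves A {[]}"
| node: "(\<And>a. a \<in> A \<Longrightarrow> complete_leaves A (F a)) \<Longrightarrow> complete_leaves A (\<Union>a\<in>A. (#) a ` F a)"

lemma complete_leaves_finite: "complete_leaves A W \<Longrightarrow> finite A \<Longrightarrow> finite W"
  by (induction rule: complete_leaves.induct) auto

lemma complete_leaves_subset: "complete_leaves A W \<Longrightarrow> W \<subseteq> lists A"
proof (induction rule: complete_leaves.induct)
  case (node F)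
  then have "a # w \<in> lists A" if "a \<in> A" "w \<in> F a" for a w
    using that by (meson Cons_in_lists_iff subsetD)
  then show ?case by blast
qed simp

text \<open>A message descends from the root along a single branch of a finite tree and so meets
  exactly one leaf.\<close>

lemma complete_leaves_prefix:
  assumes "complete_leaves A W" "x \<in> streams A"
  shows "\<exists>!w. w \<in> W \<and> (\<exists>y. x = w @- y)"
  using assms
proof (induction arbitrary: x rule: complete_leaves.induct)
  case root
  then show ?case by auto
next
  case (node F)
  obtain a y where x: "x = a ## y"
    by (cases x)
  with node.prems have a: "a \<in> A" and y: "y \<in> streams A"
    by (auto simp: streams_Stream)
  obtain w where w: "w \<in> F a" "\<exists>z. y = w @- z" and uniq: "\<And>v. v \<in> F a \<Longrightarrow> \<exists>z. y = v @- z \<Longrightarrow> v = w"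
    using node.IH[OF a y] by blast
  show ?case
  proof (rule ex1I[of _ "a # w"])
    show "a # w \<in> (\<Union>a\<in>A. (#) a ` F a) \<and> (\<exists>z. x = (a # w) @- z)"
      using a w x by auto
    fix v
    assume "v \<in> (\<Union>a\<in>A. (#) a ` F a) \<and> (\<exists>z. x = v @- z)"
    then show "v = a # w"
      using uniq x by auto
  qed
qed

text \<open>Existence comes from splitting off the unique first word \<open>f x\<close> and
  iterating on the rest \<open>g x\<close>. Uniqueness holds because the head of any factorization
  of \<open>x\<close> is a word of \<open>W\<close> that is a prefix of \<open>x\<close>, hence
  equals \<open>f x\<close>.\<close>

lemma ex1_flat_eq:
  assumes W: "[] \<notin> W" "W \<subseteq> lists A"
    and pre: "\<And>x. x \<in> streams A \<Longrightarrow> \<exists>!w. w \<in> W \<and> (\<exists>y. x = w @- y)"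
    and x: "x \<in> streams A"
  shows "\<exists>!ws. ws \<in> streams W \<and> flat ws = x"
proof -
  define f where "f x = (THE w. w \<in> W \<and> (\<exists>y. x = w @- y))" for x
  define g where "g x = sdrop (length (f x)) x" for x
  define parse where "parse x = smap f (siterate g x)" for x
  have f: "f x \<in> W" "x = f x @- g x" if "x \<in> streams A" for x
  proof -
    have *: "f x \<in> W \<and> (\<exists>y. x = f x @- y)"
      unfolding f_def by (rule theI') (rule pre[OF that])
    then show "f x \<in> W" "x = f x @- g x"
      by (auto simp: g_def sdrop_shift) (metis sdrop_shift drop_all order_refl diff_self_eq_0 sdrop.simps(1) shift.simps(1))
  qed
  have f_eq: "f (w @- y) = w" if "w \<in> W" "y \<in> streams A" for w y
  proof -
    have "w @- y \<in> streams A"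
      using that W(2) by (intro shift_streams) auto
    from pre[OF this] f[OF this] show ?thesis
      using that(1) by blast
  qed
  have g: "g x \<in> streams A" if "x \<in> streams A" for x
    using that by (auto simp: g_def streams_iff_snth sdrop_snth)
  have flat_parse: "flat (parse x) = x" if "x \<in> streams A" for x
  proof -
    have parse: "parse x = f x ## parse (g x)" for x
      by (simp add: parse_def siterate.code[of g x])
    \<comment> \<open>Equality of streams is checked on finite prefixes. Since \<open>f x\<close> is
      nonempty, removing it shortens the prefix still to be compared.\<close>
    have "stake n (flat (parse x)) = stake n x" if "x \<in> streams A" for n
      using that
    proof (induction n arbitrary: x rule: less_induct)
      case (less n)
      have ne: "f x \<noteq> []"
        using f(1)[OF less.prems] W(1) by metis
      show ?case
      proof (cases "n = 0")
        case False
        then have "stake (n - length (f x)) (flat (parse (g x))) = stake (n - length (f x)) (g x)"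
          using ne by (intro less.IH g less.prems) auto
        then have "stake n (f x @- flat (parse (g x))) = stake n (f x @- g x)"
          by (simp add: stake_shift)
        then show ?thesis
          using f(2)[OF less.prems] ne parse[of x] by simp
      qed simp
    qed
    then have "flat (parse x) !! n = x !! n" for n
      using that by (metis lessI stake_nth)
    then show ?thesis
      by (metis ext stream_smap_nats)
  qed
  have unique: "ws = vs" if "ws \<in> streams W" "vs \<in> streams W" "flat ws = flat vs" for ws vs
    using that
  \<comment> \<open>The bisimulation relates streams over \<open>W\<close> with equal flattening;
    \<open>f\<close> recovers the common head, after which the tails flatten equally again.\<close>
  proof (coinduction arbitrary: ws vs)
    case Eq_stream
    have flatA: "flat us \<in> streams A" if "us \<in> streams W" for us
    proof -
      have "\<forall>xs\<in>sset us. xs \<noteq> []" "\<forall>xs\<in>sset us. set xs \<subseteq> A"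
        using that W by (auto simp: streams_iff_sset)
      then show ?thesis
        by (auto simp: streams_iff_sset)
    qed
    have hd: "shd us \<in> W" "stl us \<in> streams W" "flat us = shd us @- flat (stl us)"
      if "us \<in> streams W" for us
      using streams_shd[OF that] streams_stl[OF that] flat_unfold[of us] W(1) by metis+
    have "f (flat us) = shd us" if "us \<in> streams W" for us
      using hd[OF that] f_eq flatA by metis
    then have "shd ws = shd vs"
      using Eq_stream by metis
    moreover have "flat (stl ws) = flat (stl vs)"
      using Eq_stream hd calculation by (metis shift_left_inj)
    ultimately show ?case
      using hd Eq_stream by blast
  qed
  have "parse x \<in> streams W"
    unfolding parse_def streams_iff_snth
  proof
    fix n
    have "(g ^^ n) x \<in> streams A"
      using x g by (induction n) auto
    then show "smap f (siterate g x) !! n \<in> W"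
      by (simp add: f(1))
  qed
  then show ?thesis
    using flat_parse[OF x] unique by blast
qed

section \<open>Word probabilities and codes of fixed output length\<close>

lemma word_prob_Nil [simp]: "word_prob p [] = 1"
  and word_prob_Cons [simp]: "word_prob p (a # w) = p a * word_prob p w"
  and word_prob_append: "word_prob p (v @ w) = word_prob p v * word_prob p w"
  by (simp_all add: word_prob_def)

text \<open>Equal output lengths make block boundaries visible, so injectivity on single words gives
  decipherability. \<open>L > 0\<close> prevents a nonempty list of words from being coded by the
  empty word.\<close>

lemma complete_leaves_inj_code:
  assumes A: "finite A" and W: "complete_leaves A W" "[] \<notin> W"
    and B: "finite B" "card W \<le> card B ^ L"
    and L: "L > 0"
  obtains \<phi> where "word_based_code A B W \<phi>" "decipherable W \<phi>" "\<And>w. w \<in> W \<Longrightarrow> length (\<phi> w) = L"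
proof -
  have fin: "finite W"
    using complete_leaves_finite W A by blast
  have "finite {xs. set xs \<subseteq> B \<and> length xs = L}" "card W \<le> card {xs. set xs \<subseteq> B \<and> length xs = L}"
    using B by (auto simp: card_lists_length_eq finite_lists_length_eq)
  from card_le_inj[OF fin this] obtain \<phi>
    where \<phi>: "\<phi> ` W \<subseteq> {xs. set xs \<subseteq> B \<and> length xs = L}" "inj_on \<phi> W"
    by blast
  show thesis
  proof
    show len: "length (\<phi> w) = L" if "w \<in> W" for w
      using \<phi>(1) that by auto
    show "word_based_code A B W \<phi>"
      unfolding word_based_code_def
    proof (intro conjI ballI)
      show "W \<subseteq> lists A"
        by (rule complete_leaves_subset[OF W(1)])
      then show "\<exists>!ws. ws \<in> streams W \<and> flat ws = x" if "x \<in> streams A" for x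
        using ex1_flat_eq[OF W(2) _ complete_leaves_prefix[OF W(1)] that] by blast
      show "\<phi> ` W \<subseteq> lists B"
        using \<phi>(1) by (auto simp: in_lists_conv_set)
    qed (use W(2) fin in auto)
    have "us = vs"
      if "us \<in> lists W" "vs \<in> lists W" "concat (map \<phi> us) = concat (map \<phi> vs)" for us vs
      using that
    proof (induction us arbitrary: vs rule: list.induct)
      case Nil
      then show ?case
        using len L by (cases vs) auto
    next
      case (Cons u us)
      then obtain v vs' where vs: "vs = v # vs'"
        using len L by (cases vs) auto
      then have "\<phi> u = \<phi> v" "concat (map \<phi> us) = concat (map \<phi> vs')"
        using Cons.prems len by auto
      then show ?case
        using vs Cons \<phi>(2) by (auto dest: inj_onD)
    qed
    then show "decipherable W \<phi>"
      by (simp add: decipherable_def)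
  qed
qed

lemma sum_UN_Cons:
  assumes "finite A" "\<And>a. a \<in> A \<Longrightarrow> finite (F a)"
  shows "(\<Sum>w\<in>(\<Union>a\<in>A. (#) a ` F a). g w) = (\<Sum>a\<in>A. \<Sum>w\<in>F a. g (a # w))"
  using assms by (subst sum.UNION_disjoint) (auto simp: sum.reindex)

section \<open>Entropy of the leaves of a complete tree\<close>

locale bernoulli_source =
  fixes A :: "'a set" and p :: "'a \<Rightarrow> real"
  assumes finite_A: "finite A" and card_A: "card A \<ge> 2"
    and p_pos: "a \<in> A \<Longrightarrow> p a > 0" and sum_p: "(\<Sum>a\<in>A. p a) = 1"
begin

lemma p_less_1: "a \<in> A \<Longrightarrow> p a < 1"
proof -
  assume a: "a \<in> A"
  have "A - {a} \<noteq> {}"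
    using card_A card_mono[of "{a}" A] by auto
  then have "sum p (A - {a}) > 0"
    using finite_A p_pos by (intro sum_pos) auto
  then show ?thesis
    using sum_p sum.remove[OF finite_A a, of p] by simp
qed

lemma word_prob_pos: "w \<in> lists A \<Longrightarrow> word_prob p w > 0"
  by (induction w) (auto simp: p_pos)

lemma word_prob_le_1: "w \<in> lists A \<Longrightarrow> word_prob p w \<le> 1"
proof (induction w)
  case (Cons a w)
  then have "p a * word_prob p w \<le> 1 * 1"
    using p_less_1[of a] p_pos[of a] word_prob_pos[of w] by (intro mult_mono) auto
  then show ?case by simp
qed simp

lemma sum_word_prob: "complete_leaves A W \<Longrightarrow> (\<Sum>w\<in>W. word_prob p w) = 1"
proof (induction rule: complete_leaves.induct)
  case (node F)
  have "(\<Sum>w\<in>(\<Union>a\<in>A. (#) a ` F a). word_prob p w) = (\<Sum>a\<in>A. p a * (\<Sum>w\<in>F a. word_prob p w))"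
    using node.hyps complete_leaves_finite finite_A by (subst sum_UN_Cons) (auto simp: sum_distrib_left)
  also have "\<dots> = 1"
    using node.IH sum_p by simp
  finally show ?case .
qed simp

text \<open>The chain rule for entropy, applied along the paths of the tree.\<close>
lemma leaf_entropy:
  "complete_leaves A W \<Longrightarrow>
    - (\<Sum>w\<in>W. word_prob p w * log 2 (word_prob p w)) = avg_delay p W * source_entropy A p"
proof (induction rule: complete_leaves.induct)
  case root
  then show ?case by (simp add: avg_delay_def)
next
  case (node F)
  let ?W = "\<Union>a\<in>A. (#) a ` F a" and ?H = "source_entropy A p"
  have fin: "finite (F a)" if "a \<in> A" for a
    using node.hyps complete_leaves_finite finite_A that by blast
  have one: "(\<Sum>w\<in>F a. word_prob p w) = 1" if "a \<in> A" for a
    using sum_word_prob node.hyps that by blast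
  have delay: "avg_delay p ?W = 1 + (\<Sum>a\<in>A. p a * avg_delay p (F a))"
  proof -
    have "avg_delay p ?W = (\<Sum>a\<in>A. \<Sum>w\<in>F a. p a * word_prob p w * (1 + real (length w)))"
      unfolding avg_delay_def using finite_A fin by (subst sum_UN_Cons) auto
    also have "\<dots> = (\<Sum>a\<in>A. p a * (\<Sum>w\<in>F a. word_prob p w) + p a * avg_delay p (F a))"
      by (simp add: avg_delay_def distrib_left sum.distrib sum_distrib_left mult.assoc)
    also have "\<dots> = 1 + (\<Sum>a\<in>A. p a * avg_delay p (F a))"
      using one sum_p by (simp add: sum.distrib)
    finally show ?thesis .
  qed
  have "(\<Sum>w\<in>?W. word_prob p w * log 2 (word_prob p w)) =
      (\<Sum>a\<in>A. \<Sum>w\<in>F a. p a * word_prob p w * log 2 (p a * word_prob p w))"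
    using finite_A fin by (subst sum_UN_Cons) auto
  \<comment> \<open>The logarithm of the product splits. The \<open>log 2 (p a)\<close> part is
    weighted by the total mass 1 of the subtree and yields the source entropy; the other part is
    left to the induction hypothesis.\<close>
  also have "\<dots> = (\<Sum>a\<in>A. p a * log 2 (p a) * (\<Sum>w\<in>F a. word_prob p w)
      + p a * (\<Sum>w\<in>F a. word_prob p w * log 2 (word_prob p w)))"
  proof (rule sum.cong[OF refl])
    fix a assume a: "a \<in> A"
    have "(\<Sum>w\<in>F a. p a * word_prob p w * log 2 (p a * word_prob p w)) =
        (\<Sum>w\<in>F a. p a * log 2 (p a) * word_prob p w + p a * (word_prob p w * log 2 (word_prob p w)))"
    proof (rule sum.cong[OF refl])
      fix w assume "w \<in> F a"
      then have "word_prob p w > 0"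
        using complete_leaves_subset[OF node.hyps[OF a]] by (intro word_prob_pos) (rule subsetD)
      then show "p a * word_prob p w * log 2 (p a * word_prob p w) =
          p a * log 2 (p a) * word_prob p w + p a * (word_prob p w * log 2 (word_prob p w))"
        using p_pos[OF a] by (simp add: log_mult algebra_simps)
    qed
    then show "(\<Sum>w\<in>F a. p a * word_prob p w * log 2 (p a * word_prob p w)) =
        p a * log 2 (p a) * (\<Sum>w\<in>F a. word_prob p w) + p a * (\<Sum>w\<in>F a. word_prob p w * log 2 (word_prob p w))"
      by (simp add: sum.distrib sum_distrib_left)
  qed
  also have "\<dots> = (\<Sum>a\<in>A. p a * log 2 (p a) - p a * avg_delay p (F a) * ?H)"
  proof (rule sum.cong[OF refl])
    fix a assume a: "a \<in> A"
    have "(\<Sum>w\<in>F a. word_prob p w * log 2 (word_prob p w)) = - (avg_delay p (F a) * ?H)"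
      using node.IH[OF a] by linarith
    then show "p a * log 2 (p a) * (\<Sum>w\<in>F a. word_prob p w)
        + p a * (\<Sum>w\<in>F a. word_prob p w * log 2 (word_prob p w)) =
        p a * log 2 (p a) - p a * avg_delay p (F a) * ?H"
      using one[OF a] by (simp add: algebra_simps)
  qed
  also have "\<dots> = - ?H - (\<Sum>a\<in>A. p a * avg_delay p (F a)) * ?H"
    unfolding sum_subtractf sum_distrib_right by (simp add: source_entropy_def)
  also have "\<dots> = - (avg_delay p ?W * ?H)"
    by (simp add: delay algebra_simps)
  finally show ?case
    by simp
qed

section \<open>Threshold trees\<close>

text \<open>Each further letter strictly lowers the probability, so comparing the parent
  \<open>butlast w\<close> with \<open>t\<close> already excludes that any earlier prefix has
  reached the threshold.\<close>

definition threshold_leaves :: "real \<Rightarrow> 'a list set" where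
  "threshold_leaves t = {w \<in> lists A. word_prob p w \<le> t \<and> (w \<noteq> [] \<longrightarrow> t < word_prob p (butlast w))}"

lemma threshold_leaves_ge_1: "t \<ge> 1 \<Longrightarrow> threshold_leaves t = {[]}"
  using word_prob_le_1
  by (fastforce simp: threshold_leaves_def dest: in_set_butlastD)

text \<open>After the letter \<open>a\<close> the remaining word faces the threshold
  \<open>t / p a\<close>; this recursion matches the \<open>node\<close> rule.\<close>

lemma threshold_leaves_less_1:
  assumes "t < 1"
  shows "threshold_leaves t = (\<Union>a\<in>A. (#) a ` threshold_leaves (t / p a))"
proof -
  have "a # w \<in> threshold_leaves t \<longleftrightarrow> w \<in> threshold_leaves (t / p a)" if "a \<in> A" for a w
    using that p_pos[OF that] assms by (auto simp: threshold_leaves_def field_simps)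
  moreover have "[] \<notin> threshold_leaves t"
    using assms by (simp add: threshold_leaves_def)
  moreover have "threshold_leaves t \<subseteq> lists A"
    by (auto simp: threshold_leaves_def)
  ultimately show ?thesis
    by (auto simp: image_iff) (metis Cons_in_lists_iff list.exhaust subsetD)
qed

text \<open>Each level multiplies the threshold by at least \<open>1 / q\<close>, where
  \<open>q < 1\<close> is the largest symbol probability. Hence \<open>q ^ k \<le> t\<close> bounds
  the depth by \<open>k\<close>, and induction on \<open>k\<close> applies.\<close>

lemma complete_threshold_leaves:
  assumes "t > 0"
  shows "complete_leaves A (threshold_leaves t)"
proof -
  define q where "q = Max (p ` A)"
  have A: "A \<noteq> {}"
    using card_A by auto
  have q: "p a \<le> q" if "a \<in> A" for a
    unfolding q_def using finite_A that by simp
  have "q \<in> p ` A"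
    unfolding q_def using finite_A A by simp
  then have q01: "0 < q" "q < 1"
    using p_pos p_less_1 by auto
  have "complete_leaves A (threshold_leaves t)" if "q ^ k \<le> t" for k t
    using that
  proof (induction k arbitrary: t)
    case 0
    then show ?case
      by (simp add: threshold_leaves_ge_1 complete_leaves.root)
  next
    case (Suc k)
    show ?case
    proof (cases "t < 1")
      case True
      have "q ^ k \<le> t / p a" if "a \<in> A" for a
      proof -
        have "q ^ k * p a \<le> q ^ k * q"
          using q[OF that] q01 by (intro mult_left_mono) auto
        also have "\<dots> \<le> t"
          using Suc.prems by (simp add: mult.commute)
        finally show ?thesis
          using p_pos[OF that] by (simp add: field_simps)
      qed
      then show ?thesis
        unfolding threshold_leaves_less_1[OF True] by (intro complete_leaves.node Suc.IH)
    qed (simp add: threshold_leaves_ge_1 complete_leaves.root)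
  qed
  moreover obtain k where "q ^ k < t"
    using real_arch_pow_inv[OF assms q01(2)] by blast
  ultimately show ?thesis
    by (meson less_imp_le)
qed

lemma avg_delay_pos:
  assumes "0 < t" "t < 1"
  shows "avg_delay p (threshold_leaves t) > 0"
proof -
  have "1 = (\<Sum>w\<in>threshold_leaves t. word_prob p w)"
    using sum_word_prob complete_threshold_leaves assms by metis
  also have "\<dots> \<le> avg_delay p (threshold_leaves t)"
    unfolding avg_delay_def
  proof (rule sum_mono)
    fix w assume w: "w \<in> threshold_leaves t"
    then have "w \<noteq> []" "w \<in> lists A"
      using assms by (auto simp: threshold_leaves_def)
    then have "word_prob p w * 1 \<le> word_prob p w * real (length w)"
      using word_prob_pos[of w] by (intro mult_left_mono) (auto simp: Suc_le_eq)
    then show "word_prob p w \<le> word_prob p w * real (length w)"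
      by simp
  qed
  finally show ?thesis by simp
qed

section \<open>Redundancy of threshold codes\<close>

lemma card_threshold_leaves:
  assumes "0 < t" and s: "\<And>w. w \<in> threshold_leaves t \<Longrightarrow> s \<le> word_prob p w"
  shows "real (card (threshold_leaves t)) * s \<le> 1"
  using sum_mono[of "threshold_leaves t" "\<lambda>_. s" "word_prob p"] s
    sum_word_prob[OF complete_threshold_leaves[OF assms(1)]] by simp

lemma ex_threshold_code:
  assumes t: "0 < t" "t < 1"
    and B: "finite B" "card B \<ge> 2" "card (threshold_leaves t) \<le> card B ^ L"
    and L: "L > 0"
  obtains \<phi> where "word_based_code A B (threshold_leaves t) \<phi>" "decipherable (threshold_leaves t) \<phi>"
    "\<And>w. w \<in> threshold_leaves t \<Longrightarrow> length (\<phi> w) = L"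
    "redundancy A B p (threshold_leaves t) \<phi>
      \<le> (real L - log (card B) (1 / t)) / avg_delay p (threshold_leaves t)"
proof -
  let ?W = "threshold_leaves t"
  let ?N = "avg_delay p ?W"
  have W: "complete_leaves A ?W"
    using complete_threshold_leaves t by blast
  have Nil: "[] \<notin> ?W"
    using t by (auto simp: threshold_leaves_def)
  obtain \<phi> where \<phi>: "word_based_code A B ?W \<phi>" "decipherable ?W \<phi>"
    "\<And>w. w \<in> ?W \<Longrightarrow> length (\<phi> w) = L"
    using complete_leaves_inj_code[OF finite_A W Nil B(1,3) L] by auto
  have N: "?N > 0"
    using avg_delay_pos t by blast
  have len: "(\<Sum>w\<in>?W. word_prob p w * real (length (\<phi> w))) = real L"
    using \<phi>(3) sum_word_prob[OF W] by (simp flip: sum_distrib_right)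
  \<comment> \<open>Written as an average over the leaves, the constant can be compared with the
    leaf entropy term by term.\<close>
  have "log 2 (1 / t) = (\<Sum>w\<in>?W. word_prob p w * log 2 (1 / t))"
    using sum_word_prob[OF W] by (simp flip: sum_distrib_right)
  also have "\<dots> \<le> (\<Sum>w\<in>?W. word_prob p w * - log 2 (word_prob p w))"
  proof (rule sum_mono)
    fix w assume "w \<in> ?W"
    then have w: "0 < word_prob p w" "word_prob p w \<le> t"
      using word_prob_pos by (auto simp: threshold_leaves_def)
    then have "log 2 (1 / t) \<le> - log 2 (word_prob p w)"
      using t by (simp add: log_divide)
    then show "word_prob p w * log 2 (1 / t) \<le> word_prob p w * - log 2 (word_prob p w)"
      using w by (intro mult_left_mono) auto
  qed
  also have "\<dots> = ?N * source_entropy A p"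
    using leaf_entropy[OF W] by (simp add: sum_negf)
  finally have "log 2 (1 / t) / log 2 (card B) \<le> ?N * source_entropy A p / log 2 (card B)"
    using B by (intro divide_right_mono) auto
  moreover have "log (card B) (1 / t) = log 2 (1 / t) / log 2 (card B)"
    using t B by (intro log_base_change) auto
  ultimately have "real L - ?N * source_entropy A p / log 2 (card B) \<le> real L - log (card B) (1 / t)"
    by simp
  then have "(real L - ?N * source_entropy A p / log 2 (card B)) / ?N \<le> (real L - log (card B) (1 / t)) / ?N"
    using N by (intro divide_right_mono) auto
  moreover have "redundancy A B p ?W \<phi> = (real L - ?N * source_entropy A p / log 2 (card B)) / ?N"
    using N by (simp add: redundancy_def len diff_divide_distrib)
  ultimately show thesis
    using that \<phi> by metis
qed

section \<open>Arbitrary sources\<close>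

lemma ex_code_redundancy:
  assumes B: "finite B" "card B \<ge> 2"
  shows "\<exists>c>0. \<forall>L. real L \<ge> log (card B) (card A) \<longrightarrow>
    (\<exists>W \<phi>. word_based_code A B W \<phi> \<and> decipherable W \<phi> \<and> (\<forall>w\<in>W. length (\<phi> w) = L) \<and>
      redundancy A B p W \<phi> \<le> c / avg_delay p W)"
proof -
  let ?n = "real (card B)"
  define r where "r = Min (p ` A)"
  have A: "A \<noteq> {}"
    using card_A by auto
  have r: "r \<le> p a" if "a \<in> A" for a
    unfolding r_def using finite_A that by simp
  have "r \<in> p ` A"
    unfolding r_def using finite_A A by simp
  then have r01: "0 < r" "r < 1"
    using p_pos p_less_1 by auto
  \<comment> \<open>This is the cost of overshooting the threshold by one symbol. The same constant
    bounds \<open>L\<close> when \<open>L\<close> is too small for a threshold below 1.\<close>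
  define c where "c = log ?n (1 / r)"
  have n: "?n > 1"
    using B by simp
  have "c > 0"
    unfolding c_def using r01 n by simp
  moreover have "\<exists>W \<phi>. word_based_code A B W \<phi> \<and> decipherable W \<phi> \<and> (\<forall>w\<in>W. length (\<phi> w) = L) \<and>
      redundancy A B p W \<phi> \<le> c / avg_delay p W"
    if L: "real L \<ge> log ?n (card A)" for L
  proof -
    have "0 < log ?n (card A)"
      using n card_A by simp
    then have L0: "L > 0"
      using L by linarith
    have "real (card A) \<le> ?n ^ L"
      using L n card_A by (simp add: log_le_iff powr_realpow)
    then have AL: "card A \<le> card B ^ L"
      by (metis of_nat_le_iff of_nat_power)
    have *: ?thesis
      if t: "0 < t" "t < 1" "card (threshold_leaves t) \<le> card B ^ L"
        and le: "real L - log ?n (1 / t) \<le> c" for t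
    proof -
      obtain \<phi> where \<phi>: "word_based_code A B (threshold_leaves t) \<phi>" "decipherable (threshold_leaves t) \<phi>"
        "\<And>w. w \<in> threshold_leaves t \<Longrightarrow> length (\<phi> w) = L"
        "redundancy A B p (threshold_leaves t) \<phi>
          \<le> (real L - log ?n (1 / t)) / avg_delay p (threshold_leaves t)"
        using ex_threshold_code[OF t(1,2) B t(3) L0] by blast
      have "(real L - log ?n (1 / t)) / avg_delay p (threshold_leaves t)
          \<le> c / avg_delay p (threshold_leaves t)"
        using le avg_delay_pos[OF t(1,2)] by (intro divide_right_mono) auto
      then show ?thesis
        using \<phi> by (meson order_trans)
    qed
    show ?thesis
    proof (cases "?n ^ L * r > 1")
      case True
      define t where "t = 1 / (?n ^ L * r)"
      have nr: "?n ^ L * r > 0"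
        using True by linarith
      have t: "0 < t" "t < 1"
        using True nr unfolding t_def by auto
      \<comment> \<open>The parent of a leaf lies above \<open>t\<close>, and the last letter costs
        at most a factor \<open>r\<close>.\<close>
      have "t * r \<le> word_prob p w" if "w \<in> threshold_leaves t" for w
      proof -
        have w: "w \<in> lists A" "w \<noteq> []" "t < word_prob p (butlast w)"
          using that t by (auto simp: threshold_leaves_def)
        have "word_prob p w = word_prob p (butlast w) * p (last w)"
          using word_prob_append[of p "butlast w" "[last w]"] w(2) by simp
        moreover have "t * r \<le> word_prob p (butlast w) * p (last w)"
          using w r[of "last w"] r01 t by (intro mult_mono) auto
        ultimately show ?thesis by simp
      qed
      then have "real (card (threshold_leaves t)) * (t * r) \<le> 1"
        by (rule card_threshold_leaves[OF t(1)])
      then have "real (card (threshold_leaves t)) \<le> ?n ^ L"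
        using n r01 by (simp add: t_def field_simps)
      then have card: "card (threshold_leaves t) \<le> card B ^ L"
        by (metis of_nat_le_iff of_nat_power)
      have "log ?n (1 / t) = real L - c"
        using n r01 by (simp add: t_def c_def log_mult log_divide log_nat_power)
      then show ?thesis
        using *[OF t card] by simp
    next
      case False
      \<comment> \<open>The largest symbol probability as threshold makes the leaves exactly the
        single letters. The hypothesis on \<open>L\<close> supplies enough output words for them,
        and \<open>?n ^ L * r \<le> 1\<close> gives \<open>L \<le> c\<close>.\<close>
      define q where "q = Max (p ` A)"
      have "q \<in> p ` A"
        unfolding q_def using finite_A A by simp
      then have q01: "0 < q" "q < 1"
        using p_pos p_less_1 by auto
      have "p a \<le> q" if "a \<in> A" for a
        unfolding q_def using finite_A that by simp
      then have "threshold_leaves (q / p a) = {[]}" if "a \<in> A" for a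
        using that p_pos by (intro threshold_leaves_ge_1) auto
      then have "threshold_leaves q = (\<lambda>a. [a]) ` A"
        using threshold_leaves_less_1[OF q01(2)] by auto
      then have "card (threshold_leaves q) = card A"
        by (simp add: card_image inj_on_def)
      moreover have "real L \<le> c"
      proof -
        have "?n ^ L \<le> 1 / r"
          using False r01 by (simp add: field_simps)
        then show ?thesis
          using n r01 by (simp add: c_def le_log_iff powr_realpow)
      qed
      moreover have "log ?n (1 / q) \<ge> 0"
        using q01 n by simp
      ultimately show ?thesis
        using *[OF q01] AL by simp
    qed
  qed
  ultimately show ?thesis
    by blast
qed

section \<open>Uniform sources\<close>

lemma uniform_threshold_leaves:
  assumes uniform: "\<And>a. a \<in> A \<Longrightarrow> p a = 1 / card A"
  shows "threshold_leaves (1 / card A ^ k) = {w. set w \<subseteq> A \<and> length w = k}"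
proof -
  have m: "real (card A) > 1"
    using card_A by simp
  have wp: "word_prob p w = 1 / card A ^ length w" if "w \<in> lists A" for w
    using that by (induction w) (auto simp: uniform)
  have "w \<in> threshold_leaves (1 / card A ^ k) \<longleftrightarrow> length w = k" if w: "w \<in> lists A" for w
  proof -
    have "butlast w \<in> lists A"
      using w by (auto dest: in_set_butlastD)
    \<comment> \<open>Probabilities depend on length alone, so both threshold tests become tests on
      lengths. The truncated subtraction is guarded by \<open>w \<noteq> []\<close>.\<close>
    then have "w \<in> threshold_leaves (1 / card A ^ k) \<longleftrightarrow>
        k \<le> length w \<and> (w \<noteq> [] \<longrightarrow> length w - 1 < k)"
      using w m by (simp add: threshold_leaves_def wp frac_le_eq divide_simps)
    then show ?thesis
      by (cases w) auto
  qed
  moreover have "threshold_leaves (1 / card A ^ k) \<subseteq> lists A"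
    by (auto simp: threshold_leaves_def)
  ultimately show ?thesis
    by (auto simp: in_lists_conv_set)
qed

lemma ex_uniform_code_redundancy:
  assumes uniform: "\<And>a. a \<in> A \<Longrightarrow> p a = 1 / card A"
    and B: "finite B" "card B \<ge> 2"
  shows "infinite {L. L > 0 \<and>
    (\<exists>W \<phi>. word_based_code A B W \<phi> \<and> decipherable W \<phi> \<and> (\<forall>w\<in>W. length (\<phi> w) = L) \<and>
      redundancy A B p W \<phi> \<le> 1 / (avg_delay p W)\<^sup>2)}" (is "infinite ?S")
proof -
  let ?m = "real (card A)" and ?n = "real (card B)"
  define \<alpha> where "\<alpha> = log ?m ?n"
  have m: "?m > 1" and n: "?n > 1"
    using card_A B by auto
  have \<alpha>: "\<alpha> > 0"
    unfolding \<alpha>_def using m n by simp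
  let ?G = "{L::nat. L > 0 \<and> (\<exists>k::int. 0 \<le> real L * \<alpha> - k \<and> real L * \<alpha> - k \<le> 1 / real L)}"
  \<comment> \<open>Requiring \<open>L > 1 / \<alpha>\<close> forces \<open>k' > 0\<close>, hence a
    threshold below 1, and discards only finitely many \<open>L\<close>.\<close>
  have main: "L \<in> ?S" if G: "L \<in> ?G" "L > nat \<lceil>1 / \<alpha>\<rceil>" for L
  proof -
    obtain k' :: int where L: "L > 0" and k': "0 \<le> real L * \<alpha> - k'" "real L * \<alpha> - k' \<le> 1 / real L"
      using G(1) by auto
    have "1 / \<alpha> < real L"
      using G(2) by linarith
    then have "1 < real L * \<alpha>"
      using \<alpha> by (simp add: field_simps)
    moreover have "1 / real L \<le> 1"
      using L by simp
    ultimately have "k' > 0"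
      using k' by linarith
    then obtain k :: nat where k: "k > 0" "k' = int k"
      by (metis of_nat_0_less_iff zero_less_imp_eq_int)
    define t where "t = 1 / ?m ^ k"
    have t: "0 < t" "t < 1"
      using m k(1) by (auto simp: t_def)
    have W: "threshold_leaves t = {w. set w \<subseteq> A \<and> length w = k}"
      using uniform_threshold_leaves[of k, OF uniform] by (simp add: t_def)
    have "?m ^ k = ?m powr k"
      using m by (simp add: powr_realpow)
    also have "\<dots> \<le> ?m powr (real L * \<alpha>)"
      using k' k m by (intro powr_mono) auto
    also have "\<dots> = (?m powr \<alpha>) powr L"
      by (simp add: powr_powr mult.commute)
    also have "\<dots> = ?n ^ L"
      using m n by (simp add: \<alpha>_def powr_realpow)
    finally have "card A ^ k \<le> card B ^ L"
      by (metis of_nat_le_iff of_nat_power)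
    then have card: "card (threshold_leaves t) \<le> card B ^ L"
      using finite_A by (simp add: W card_lists_length_eq)
    have "avg_delay p (threshold_leaves t) = (\<Sum>w\<in>threshold_leaves t. word_prob p w * real k)"
      unfolding avg_delay_def by (intro sum.cong) (auto simp: W)
    then have N: "avg_delay p (threshold_leaves t) = real k"
      using sum_word_prob[OF complete_threshold_leaves[OF t(1)]] by (simp flip: sum_distrib_right)
    have "log ?n (1 / t) = real k / \<alpha>"
      using m n by (simp add: t_def \<alpha>_def log_def ln_realpow)
    then have "real L - log ?n (1 / t) = (real L * \<alpha> - k) / \<alpha>"
      using \<alpha> by (simp add: field_simps)
    also have "\<dots> \<le> (1 / real L) / \<alpha>"
      using k' k \<alpha> by (intro divide_right_mono) auto
    also have "\<dots> = 1 / (real L * \<alpha>)"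
      by simp
    \<comment> \<open>Since \<open>k \<le> L * \<alpha>\<close>, the error is at most the reciprocal
      of the delay \<open>k\<close>; dividing by the delay once more gives the square, with constant
      1.\<close>
    also have "\<dots> \<le> 1 / real k"
      using k' k \<alpha> L by (intro divide_left_mono) auto
    finally have "(real L - log ?n (1 / t)) / real k \<le> (1 / real k) / real k"
      by (intro divide_right_mono) auto
    also have "\<dots> = 1 / (real k)\<^sup>2"
      by (simp add: power2_eq_square)
    finally have le: "(real L - log ?n (1 / t)) / real k \<le> 1 / (real k)\<^sup>2" .
    obtain \<phi> where "word_based_code A B (threshold_leaves t) \<phi>" "decipherable (threshold_leaves t) \<phi>"
        "\<And>w. w \<in> threshold_leaves t \<Longrightarrow> length (\<phi> w) = L"
        "redundancy A B p (threshold_leaves t) \<phi> \<le> (real L - log ?n (1 / t)) / real k"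
      using ex_threshold_code[OF t B card L] N by auto
    then show ?thesis
      using L le N by (auto intro!: exI[of _ "threshold_leaves t"] exI[of _ \<phi>])
  qed
  have "?G \<subseteq> {..nat \<lceil>1 / \<alpha>\<rceil>} \<union> ?S"
  proof
    fix L assume "L \<in> ?G"
    from main[OF this] show "L \<in> {..nat \<lceil>1 / \<alpha>\<rceil>} \<union> ?S"
      by (cases "L \<le> nat \<lceil>1 / \<alpha>\<rceil>") (simp_all only: Un_iff atMost_iff not_le simp_thms)
  qed
  then show ?thesis
    using infinite_Dirichlet_approx_below[of \<alpha>] by (meson finite_UnI finite_atMost finite_subset)
qed

end

theorem theorem3:
  fixes m n :: nat and p :: "nat \<Rightarrow> real"
  assumes "m \<ge> 2" and "n \<ge> 2"
    and "\<forall>i\<in>{1..m}. p i > 0"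
    and "(\<Sum>i=1..m. p i) = 1"
  shows "(\<exists>c::real. c > 0 \<and> (\<forall>L::nat. real L \<ge> log (real n) (real m) \<longrightarrow>
            (\<exists>(W :: nat list set) (\<phi> :: nat list \<Rightarrow> nat list).
               word_based_code {1..m} {1..n} W \<phi> \<and> decipherable W \<phi> \<and>
               (\<forall>w\<in>W. length (\<phi> w) = L) \<and>
               redundancy {1..m} {1..n} p W \<phi> \<le> c / avg_delay p W))) \<and>
         ((\<forall>i\<in>{1..m}. p i = 1 / real m) \<longrightarrow>
          (\<exists>c::real. c > 0 \<and> infinite {L::nat. L > 0 \<and>
            (\<exists>(W :: nat list set) (\<phi> :: nat list \<Rightarrow> nat list).
               word_based_code {1..m} {1..n} W \<phi> \<and> decipherable W \<phi> \<and>
               (\<forall>w\<in>W. length (\<phi> w) = L) \<and>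
               redundancy {1..m} {1..n} p W \<phi> \<le> c / (avg_delay p W)\<^sup>2)}))"
proof -
  interpret bernoulli_source "{1..m}" p
    using assms by unfold_locales auto
  have n: "finite {1..n}" "card {1..n} \<ge> 2"
    using assms by auto
  show ?thesis
  proof (intro conjI impI)
    assume "\<forall>i\<in>{1..m}. p i = 1 / real m"
    then have "p i = 1 / real (card {1..m})" if "i \<in> {1..m}" for i
      using that by simp
    from ex_uniform_code_redundancy[OF this n] show "\<exists>c::real. c > 0 \<and> infinite {L::nat. L > 0 \<and>
        (\<exists>(W :: nat list set) (\<phi> :: nat list \<Rightarrow> nat list).
          word_based_code {1..m} {1..n} W \<phi> \<and> decipherable W \<phi> \<and>
          (\<forall>w\<in>W. length (\<phi> w) = L) \<and>
          redundancy {1..m} {1..n} p W \<phi> \<le> c / (avg_delay p W)\<^sup>2)}"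
      by (intro exI[of _ "1::real"] conjI zero_less_one)
  qed (use ex_code_redundancy[OF n] in \<open>simp only: card_atLeastAtMost diff_Suc_1\<close>)
qed

end
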